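(* For each integer $m\geq 0$, $$\frac{\pi}{6} = \ln\left(\frac{(9+5\sqrt{3})L_{2m}^2+(3+\sqrt{3})L_{2m} \sqrt{(2+\sqrt{3})^2L_{2m}^2+4} +4}{(5+3\sqrt{3})L_{2m}^2+(1+\sqrt{3})L_{2m}\sqrt{(2+\sqrt{3})^2L_{2m}^2+4} +4}\right) - 4\sum_{n=0}^\infty \frac{1}{4n+3} L_{2m(4n+3)} \Big (\frac{2}{(2+\sqrt{3})L_{2m} + \sqrt{(2+\sqrt{3})^2L_{2m}^2+4}}\Big )^{4n+3},$$ where $L_k$ denotes the $k$-th Lucas number.
   Context: The Lucas numbers are defined by $L_0=2$, $L_1=1$, and $L_{n+2}=L_{n+1}+L_n$ for $n\ge 0$. *)

theory Defs
  imports Complex_Main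
begin

fun lucas :: "nat \<Rightarrow> nat" where
  "lucas 0 = 2"
| "lucas (Suc 0) = 1"
| "lucas (Suc (Suc n)) = lucas (Suc n) + lucas n"

end

theory Submission
  imports Defs "HOL-Analysis.Complex_Transcendental"
begin

text \<open>
  Write \<open>L = L\<^bsub>2m\<^esub> = a + b\<close> with \<open>a = \<phi>\<^bsup>2m\<^esup>\<close>, \<open>b = \<psi>\<^bsup>2m\<^esup>\<close>, so that \<open>ab = 1\<close>, and let
  \<open>x\<close> be the base of the powers in the series, which is the positive root of
  \<open>1 - x\<^sup>2 = (2 + \<surd>3) L x\<close>. Since \<open>\<Sum> 4y\<^bsup>4n+3\<^esup> / (4n+3) = 2 artanh y - 2 arctan y\<close>, Binet's formula
  turns the series into this expression at \<open>y = ax\<close> plus that at \<open>y = bx\<close>. As \<open>ab = 1\<close>, the arctangents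
  add up to \<open>arctan (Lx / (1 - x\<^sup>2)) = arctan (2 - \<surd>3) = \<pi>/12\<close>, and the artanh terms give
  \<open>ln ((1 + Lx + x\<^sup>2) / (1 - Lx + x\<^sup>2))\<close>.
\<close>

text \<open>The series of \<open>artanh\<close> and \<open>arctan\<close> have the same odd-power
  terms up to the sign \<open>(-1) ^ k\<close>. Half their difference keeps exactly the terms with
  \<open>k = 2 * n + 1\<close>, whose exponent \<open>2 * k + 1\<close> is
  \<open>4 * n + 3\<close>.\<close>

lemma sums_artanh_minus_arctan:
  fixes y :: real
  assumes "\<bar>y\<bar> < 1"
  shows "(\<lambda>n. y ^ (4 * n + 3) / (4 * real n + 3)) sums ((artanh y - arctan y) / 2)"
proof -
  define f where "f k = 1 / real (k * 2 + 1) * y ^ (k * 2 + 1)" for k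
  have y: "-1 < y" "y < 1" using assms by linarith+
  \<comment> \<open>The library series expands \<open>ln t\<close> in powers of
    \<open>(t - 1) / (t + 1)\<close>; this choice of \<open>t\<close> turns that quotient back into
    \<open>y\<close>.\<close>
  have quot: "((1 + y) / (1 - y) - 1) / ((1 + y) / (1 - y) + 1) = y"
    using y by (simp add: field_simps)
  have "(\<lambda>k. 2 * f k) sums ln ((1 + y) / (1 - y))"
    using ln_series_quadratic[of "(1 + y) / (1 - y)"] y quot
    by (simp add: f_def mult.commute)
  then have "(\<lambda>k. f k) sums artanh y"
    unfolding artanh_def using sums_divide[of "\<lambda>k. 2 * f k" _ 2] by simp
  moreover have "(\<lambda>k. (-1) ^ k * f k) sums arctan y"
    using summable_arctan_series[of y] arctan_series[of y] assms
    unfolding f_def by (simp only: sums_iff less_imp_le)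
  ultimately have d: "(\<lambda>k. (f k - (-1) ^ k * f k) / 2) sums ((artanh y - arctan y) / 2)"
    by (intro sums_divide sums_diff)
  \<comment> \<open>Reindexing along the odd numbers preserves the sum because the terms at even
    indices vanish.\<close>
  have "(\<lambda>n. (f (2 * n + 1) - (-1) ^ (2 * n + 1) * f (2 * n + 1)) / 2) sums ((artanh y - arctan y) / 2)"
  proof (subst sums_mono_reindex[of "\<lambda>n. 2 * n + 1"])
    fix n :: nat
    assume "n \<notin> range (\<lambda>n. 2 * n + 1)"
    then have "even n" by (metis oddE rangeI)
    then show "(f n - (-1) ^ n * f n) / 2 = 0" by simp
  qed (use d in \<open>auto simp: strict_mono_def\<close>)
  moreover have "(f (2 * n + 1) - (-1) ^ (2 * n + 1) * f (2 * n + 1)) / 2 = y ^ (4 * n + 3) / (4 * real n + 3)" for n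
  proof -
    have "(2 * n + 1) * 2 + 1 = 4 * n + 3" by simp
    then have "f (2 * n + 1) = y ^ (4 * n + 3) / (4 * real n + 3)"
      by (simp only: f_def) simp
    moreover have "(f (2 * n + 1) - (-1) ^ (2 * n + 1) * f (2 * n + 1)) / 2 = f (2 * n + 1)"
      by simp
    ultimately show ?thesis by (simp only:)
  qed
  ultimately show ?thesis by simp
qed

lemma lucas_Binet:
  "real (lucas n) = ((1 + sqrt 5) / 2) ^ n + ((1 - sqrt 5) / 2) ^ n"
proof (induction n rule: lucas.induct)
  case 2
  then show ?case by (simp add: field_simps)
next
  case (3 n)
  have rec: "t ^ Suc (Suc n) = t ^ Suc n + t ^ n" if "t * t = t + 1" for t :: real
  proof -
    have "t ^ Suc (Suc n) = t * t * t ^ n" by simp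
    then show ?thesis unfolding that by (simp add: algebra_simps)
  qed
  have "((1 + sqrt 5) / 2) * ((1 + sqrt 5) / 2) = (1 + sqrt 5) / 2 + 1"
    "((1 - sqrt 5) / 2) * ((1 - sqrt 5) / 2) = (1 - sqrt 5) / 2 + 1"
    by (simp_all add: field_simps)
  from this[THEN rec] 3 show ?case by (simp del: power_Suc)
qed simp_all

text \<open>Doubling the angle gives tangent \<open>1 / sqrt 3\<close>, that is,
  \<open>pi / 6\<close>.\<close>

lemma arctan_two_minus_sqrt3: "arctan (2 - sqrt 3) = pi / 12"
proof -
  have "1 < sqrt 3" "sqrt 3 < 2" by (simp_all add: real_less_lsqrt)
  then have small: "\<bar>2 - sqrt 3\<bar> < 1" by simp
  have "2 * arctan (2 - sqrt 3) = arctan (2 * (2 - sqrt 3) / (1 - (2 - sqrt 3)\<^sup>2))"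
    using arctan_double[OF small] .
  also have "2 * (2 - sqrt 3) / (1 - (2 - sqrt 3)\<^sup>2) = 1 / sqrt 3"
    using \<open>1 < sqrt 3\<close> \<open>sqrt 3 < 2\<close> small abs_square_less_1[of "2 - sqrt 3"]
    by (simp add: divide_simps) (simp add: power2_eq_square algebra_simps)
  also have "arctan (1 / sqrt 3) = pi / 6"
    by (rule arctan_unique) (auto simp: tan_30)
  finally show ?thesis by simp
qed

text \<open>With \<open>a * b = 1\<close>, the products of \<open>1 + a * x\<close> and
  \<open>1 + b * x\<close>, and of \<open>1 - a * x\<close> and \<open>1 - b * x\<close>, depend
  only on \<open>a + b\<close> and \<open>x\<close>.\<close>

lemma artanh_add_reciprocal:
  fixes a b x :: real
  assumes "a * b = 1" "\<bar>a * x\<bar> < 1" "\<bar>b * x\<bar> < 1"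
  shows "2 * (artanh (a * x) + artanh (b * x)) =
    ln ((1 + (a + b) * x + x\<^sup>2) / (1 - (a + b) * x + x\<^sup>2))"
proof -
  have pos: "0 < 1 + a * x" "0 < 1 - a * x" "0 < 1 + b * x" "0 < 1 - b * x"
    using assms by linarith+
  have x2: "a * x * (b * x) = x\<^sup>2"
    using assms(1) by (metis mult.assoc mult.left_commute mult.right_neutral power2_eq_square)
  have "2 * (artanh (a * x) + artanh (b * x)) =
      ln ((1 + a * x) / (1 - a * x)) + ln ((1 + b * x) / (1 - b * x))"
    by (simp add: artanh_def)
  also have "\<dots> = ln ((1 + a * x) / (1 - a * x) * ((1 + b * x) / (1 - b * x)))"
    using pos by (intro ln_mult_pos[symmetric]) auto
  also have "(1 + a * x) / (1 - a * x) * ((1 + b * x) / (1 - b * x)) =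
      (1 + (a + b) * x + x\<^sup>2) / (1 - (a + b) * x + x\<^sup>2)"
    unfolding times_divide_times_eq x2[symmetric]
    by (rule arg_cong2[where f = "(/)"]) (simp_all add: algebra_simps)
  finally show ?thesis .
qed

text \<open>The quadratic relation \<open>root\<close> serves twice: it forces \<open>a * x\<close>
  and \<open>b * x\<close> below 1, so both series converge, and it makes the tangent of the
  arctangent sum a constant.\<close>

lemma reciprocal_pair_sums:
  fixes a b x :: real
  assumes "0 < a" "0 < b" "a * b = 1" "0 < x"
    and root: "1 - x\<^sup>2 = (2 + sqrt 3) * (a + b) * x"
  shows "(\<lambda>n. 1 / (4 * real n + 3) * (a ^ (4 * n + 3) + b ^ (4 * n + 3)) * x ^ (4 * n + 3)) sums
    ((ln ((1 + (a + b) * x + x\<^sup>2) / (1 - (a + b) * x + x\<^sup>2)) - pi / 6) / 4)"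
proof -
  \<comment> \<open>Since \<open>2 + sqrt 3\<close> is at least 1 and \<open>x\<^sup>2\<close> is
    positive, \<open>root\<close> bounds \<open>(a + b) * x\<close> by 1.\<close>
  have "1 * ((a + b) * x) \<le> (2 + sqrt 3) * ((a + b) * x)"
    using assms by (intro mult_right_mono) auto
  also have "\<dots> < 1"
    using root zero_less_power[OF \<open>0 < x\<close>, of 2] unfolding mult.assoc by linarith
  finally have "a * x + b * x < 1" by (simp add: algebra_simps)
  moreover have "0 < a * x" "0 < b * x" using assms by simp_all
  ultimately have small: "\<bar>a * x\<bar> < 1" "\<bar>b * x\<bar> < 1" by linarith+
  have "arctan (a * x) + arctan (b * x) = arctan ((a * x + b * x) / (1 - a * x * (b * x)))"
    using small by (intro arctan_add) auto
  also have "a * x * (b * x) = x\<^sup>2"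
    using assms(3) by (metis mult.assoc mult.left_commute mult.right_neutral power2_eq_square)
  also have "(a * x + b * x) / (1 - x\<^sup>2) = 1 / (2 + sqrt 3)"
    unfolding root using assms by (simp add: divide_simps) (simp add: algebra_simps)
  also have "\<dots> = 2 - sqrt 3"
    by (simp add: divide_simps algebra_simps add_nonneg_eq_0_iff)
  finally have arc: "arctan (a * x) + arctan (b * x) = pi / 12"
    by (simp add: arctan_two_minus_sqrt3)
  have "(\<lambda>n. (a * x) ^ (4 * n + 3) / (4 * real n + 3) + (b * x) ^ (4 * n + 3) / (4 * real n + 3)) sums
      ((artanh (a * x) - arctan (a * x)) / 2 + (artanh (b * x) - arctan (b * x)) / 2)"
    using small by (intro sums_add sums_artanh_minus_arctan)
  also have "(artanh (a * x) - arctan (a * x)) / 2 + (artanh (b * x) - arctan (b * x)) / 2 =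
      (2 * (artanh (a * x) + artanh (b * x)) - 2 * (arctan (a * x) + arctan (b * x))) / 4"
    by (simp add: field_simps)
  finally show ?thesis
    unfolding artanh_add_reciprocal[OF assms(3) small] arc
    by (simp add: power_mult_distrib add_divide_distrib distrib_right)
qed

text \<open>The denominator \<open>q\<close> of \<open>x\<close> satisfies
  \<open>q\<^sup>2 - 4 = 2 * M * q\<close>; dividing by \<open>q\<^sup>2\<close> gives the equation
  for \<open>x = 2 / q\<close>.\<close>

lemma positive_root_reciprocal:
  fixes M :: real
  defines "x \<equiv> 2 / (M + sqrt (M\<^sup>2 + 4))"
  assumes "0 < M"
  shows "0 < x" "1 - x\<^sup>2 = M * x"
proof -
  have s: "0 < sqrt (M\<^sup>2 + 4)" "(sqrt (M\<^sup>2 + 4))\<^sup>2 = M\<^sup>2 + 4"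
    by (simp_all add: add_nonneg_pos)
  show "0 < x" using assms s by (simp add: x_def add_pos_pos)
  have "(M + sqrt (M\<^sup>2 + 4))\<^sup>2 - 4 = 2 * M * (M + sqrt (M\<^sup>2 + 4))"
    using s(2) by (simp add: power2_eq_square algebra_simps)
  moreover have "M + sqrt (M\<^sup>2 + 4) \<noteq> 0" using assms s by linarith
  ultimately show "1 - x\<^sup>2 = M * x"
    unfolding x_def by (simp add: divide_simps power2_eq_square)
qed

text \<open>Both sides equal \<open>(s + L) / (s - L)\<close>: on the left a common factor
  \<open>x\<close> cancels, on the right cross-multiplication reduces to the definition of
  \<open>s\<close>.\<close>

lemma ln_argument_eq:
  fixes L :: real
  defines "s \<equiv> sqrt ((2 + sqrt 3)\<^sup>2 * L\<^sup>2 + 4)"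
  defines "x \<equiv> 2 / ((2 + sqrt 3) * L + s)"
  assumes "0 < L"
  shows "(1 + L * x + x\<^sup>2) / (1 - L * x + x\<^sup>2) =
    ((9 + 5 * sqrt 3) * L\<^sup>2 + (3 + sqrt 3) * L * s + 4) /
    ((5 + 3 * sqrt 3) * L\<^sup>2 + (1 + sqrt 3) * L * s + 4)"
proof -
  define r where "r = sqrt 3"
  have r: "r\<^sup>2 = 3" "0 < r" by (simp_all add: r_def)
  have s2: "s\<^sup>2 = (2 + r)\<^sup>2 * L\<^sup>2 + 4" by (simp add: s_def r_def)
  have "1 * L\<^sup>2 \<le> (2 + r)\<^sup>2 * L\<^sup>2"
    using r(2) by (intro mult_right_mono one_le_power) auto
  then have "L\<^sup>2 < (2 + r)\<^sup>2 * L\<^sup>2 + 4" by simp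
  then have sL: "L < s" unfolding s_def r_def by (rule real_less_rsqrt)
  have "0 < (2 + r) * L" using r assms by simp
  then have q: "0 < (2 + r) * L + s" using sL assms by linarith
  have x: "x = 2 / ((2 + r) * L + s)" by (simp add: x_def r_def)
  then have xq: "x * ((2 + r) * L + s) = 2"
    using q nonzero_eq_divide_eq[of "(2 + r) * L + s" x 2] by simp
  have root: "x\<^sup>2 = 1 - (2 + r) * L * x"
    using positive_root_reciprocal(2)[of "(2 + r) * L"] \<open>0 < (2 + r) * L\<close>
    unfolding x s_def r_def by (simp add: power_mult_distrib)
  \<comment> \<open>By \<open>root\<close> and \<open>xq\<close>,
    \<open>1 + x\<^sup>2 = 2 - (2 + r) * L * x = x * s\<close>.\<close>
  have "1 + L * x + x\<^sup>2 = x * (s + L)" "1 - L * x + x\<^sup>2 = x * (s - L)"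
    using root xq by algebra+
  moreover have "x \<noteq> 0" using xq by auto
  ultimately have "(1 + L * x + x\<^sup>2) / (1 - L * x + x\<^sup>2) = (s + L) / (s - L)" by simp
  also have "\<dots> = ((9 + 5 * r) * L\<^sup>2 + (3 + r) * L * s + 4) /
      ((5 + 3 * r) * L\<^sup>2 + (1 + r) * L * s + 4)"
  proof -
    have "0 < (5 + 3 * r) * L\<^sup>2 + (1 + r) * L * s + 4"
      using r assms sL by (intro add_nonneg_pos add_nonneg_nonneg mult_nonneg_nonneg) auto
    moreover have "(2 + r)\<^sup>2 = 7 + 4 * r"
      using r(1) by (simp add: power2_sum)
    \<comment> \<open>Up to sign, this is the difference of the two cross products compared next,
      after using \<open>r\<^sup>2 = 3\<close>.\<close>
    then have "2 * L * (s\<^sup>2 - ((7 + 4 * r) * L\<^sup>2 + 4)) = 0"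
      using s2 by simp
    then have "(s + L) * ((5 + 3 * r) * L\<^sup>2 + (1 + r) * L * s + 4) =
        ((9 + 5 * r) * L\<^sup>2 + (3 + r) * L * s + 4) * (s - L)"
      by (simp add: power2_eq_square algebra_simps)
    ultimately show ?thesis using sL by (simp add: frac_eq_eq)
  qed
  finally show ?thesis unfolding r_def .
qed

theorem theorem11:
  fixes m :: nat
  shows "summable (\<lambda>n::nat. 1 / (4 * real n + 3) * real (lucas (2 * m * (4 * n + 3))) *
            (2 / ((2 + sqrt 3) * real (lucas (2 * m)) +
              sqrt ((2 + sqrt 3)^2 * (real (lucas (2 * m)))^2 + 4))) ^ (4 * n + 3)) \<and>
    pi / 6 =
      ln (((9 + 5 * sqrt 3) * (real (lucas (2 * m)))^2 +
           (3 + sqrt 3) * real (lucas (2 * m)) *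
             sqrt ((2 + sqrt 3)^2 * (real (lucas (2 * m)))^2 + 4) + 4) /
          ((5 + 3 * sqrt 3) * (real (lucas (2 * m)))^2 +
           (1 + sqrt 3) * real (lucas (2 * m)) *
             sqrt ((2 + sqrt 3)^2 * (real (lucas (2 * m)))^2 + 4) + 4))
      - 4 * (\<Sum>n::nat. 1 / (4 * real n + 3) * real (lucas (2 * m * (4 * n + 3))) *
            (2 / ((2 + sqrt 3) * real (lucas (2 * m)) +
              sqrt ((2 + sqrt 3)^2 * (real (lucas (2 * m)))^2 + 4))) ^ (4 * n + 3))"
proof -
  define a b :: real where "a = ((1 + sqrt 5) / 2) ^ (2 * m)" and "b = ((1 - sqrt 5) / 2) ^ (2 * m)"
  define L where "L = real (lucas (2 * m))"
  define s where "s = sqrt ((2 + sqrt 3)\<^sup>2 * L\<^sup>2 + 4)"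
  define x where "x = 2 / ((2 + sqrt 3) * L + s)"
  have L: "L = a + b" by (simp add: L_def a_def b_def lucas_Binet)
  \<comment> \<open>The base of \<open>b\<close> is negative, but it is nonzero and the exponent
    \<open>2 * m\<close> is even, so \<open>b\<close> is positive; evenness likewise turns the
    product -1 of the bases into \<open>a * b = 1\<close>.\<close>
  have "sqrt 5 \<noteq> 1" by simp
  then have pos: "0 < a" "0 < b" by (auto simp: a_def b_def power_mult add_pos_pos intro!: zero_less_power)
  have "(1 + sqrt 5) / 2 * ((1 - sqrt 5) / 2) = -1" by (simp add: field_simps)
  then have ab: "a * b = 1"
    by (simp only: a_def b_def power_mult_distrib[symmetric]) simp
  have "0 < L" using L pos by simp
  then have M: "0 < (2 + sqrt 3) * L" by (simp add: add_pos_pos)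
  have x: "0 < x" "1 - x\<^sup>2 = (2 + sqrt 3) * L * x"
    using positive_root_reciprocal[OF M] by (simp_all add: x_def s_def power_mult_distrib)
  have lucas_mult: "real (lucas (2 * m * k)) = a ^ k + b ^ k" for k
    by (simp add: lucas_Binet a_def b_def power_mult)
  note S = reciprocal_pair_sums[OF pos ab x(1), folded L, OF x(2), folded lucas_mult]
  note R = ln_argument_eq[OF \<open>0 < L\<close>, folded s_def, folded x_def]
  show ?thesis
    unfolding L_def[symmetric] s_def[symmetric] x_def[symmetric] R[symmetric]
    using sums_summable[OF S] sums_unique[OF S] by simp
qed

end
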